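(* Let $\mathcal{M}$ be a matroid with set of bases $\mathcal{B}$. Then $\mathcal{M}$ has a minor $\mathcal{M}'$ isomorphic to the uniform matroid $\mathcal{U}_{3,6}$ if and only if $\Delta_{\{B_1,B_2\}}=10$ for some $B_1,B_2\in\mathcal{B}$.
   Context: $\mathcal{U}_{3,6}$ is the uniform matroid of rank $3$ on $6$ elements. A minor of $\mathcal{M}$ is a matroid $(\mathcal{M}\setminus A)/C$ with $A,C$ disjoint subsets of the ground set. For bases $B_1,B_2$ of $\mathcal{M}$, $\Delta_{\{B_1,B_2\}}$ is the number of unordered pairs $\{D_1,D_2\}$ with $D_1,D_2\in\mathcal{B}$ such that $D_1\cup D_2=B_1\cup B_2$ as multisets. *)

theory Defs
  imports Main "HOL-Library.Multiset"
begin

definition matroid :: "'a set \<Rightarrow> 'a set set \<Rightarrow> bool" where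
  "matroid E Bs \<longleftrightarrow> finite E \<and> Bs \<noteq> {} \<and> (\<forall>B\<in>Bs. B \<subseteq> E) \<and>
     (\<forall>B1\<in>Bs. \<forall>B2\<in>Bs. \<forall>x\<in>B1 - B2. \<exists>y\<in>B2 - B1. insert y (B1 - {x}) \<in> Bs)"

definition indep :: "'a set set \<Rightarrow> 'a set \<Rightarrow> bool" where
  "indep Bs I \<longleftrightarrow> (\<exists>B\<in>Bs. I \<subseteq> B)"

definition bases_of :: "'a set set \<Rightarrow> 'a set \<Rightarrow> 'a set set" where
  "bases_of Bs X = {I. I \<subseteq> X \<and> indep Bs I \<and>
      (\<forall>J. I \<subseteq> J \<and> J \<subseteq> X \<and> indep Bs J \<longrightarrow> J = I)}"

definition del_bases :: "'a set \<Rightarrow> 'a set set \<Rightarrow> 'a set \<Rightarrow> 'a set set" where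
  "del_bases E Bs A = bases_of Bs (E - A)"

definition contr_bases :: "'a set \<Rightarrow> 'a set set \<Rightarrow> 'a set \<Rightarrow> 'a set set" where
  "contr_bases E Bs C = {X. X \<subseteq> E - C \<and> (\<exists>J\<in>bases_of Bs C. X \<union> J \<in> Bs)}"

definition minor_bases :: "'a set \<Rightarrow> 'a set set \<Rightarrow> 'a set \<Rightarrow> 'a set \<Rightarrow> 'a set set" where
  "minor_bases E Bs A C = contr_bases (E - A) (del_bases E Bs A) C"

definition matroid_iso :: "'a set \<Rightarrow> 'a set set \<Rightarrow> 'b set \<Rightarrow> 'b set set \<Rightarrow> bool" where
  "matroid_iso E1 Bs1 E2 Bs2 \<longleftrightarrow> (\<exists>f. bij_betw f E1 E2 \<and> Bs2 = (\<lambda>B. f ` B) ` Bs1)"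

definition U36_ground :: "nat set" where
  "U36_ground = {0..<6}"

definition U36_bases :: "nat set set" where
  "U36_bases = {X. X \<subseteq> {0..<6} \<and> card X = 3}"

definition Delta :: "'a set set \<Rightarrow> 'a set \<Rightarrow> 'a set \<Rightarrow> nat" where
  "Delta Bs B1 B2 = card {{D1, D2} | D1 D2. D1 \<in> Bs \<and> D2 \<in> Bs \<and>
       mset_set D1 + mset_set D2 = mset_set B1 + mset_set B2}"

end

(* Let C be the intersection and S the symmetric difference of the bases B1 and B2, and let
   k = |B1 - B2|. Then Delta counts the partitions {X, S - X} of the 2k-element set S for which
   both C Un X and C Un (S - X) are bases. By multiple symmetric exchange, a consequence of matroid
   union, every subset of a block X of such a partition is the trace on X of another block, so
   Delta >= 2^(k - 1), and Delta = 10 forces k <= 4. For k <= 2 there are at most 3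
   partitions into k-sets, and for k = 3 there are exactly 10, so that Delta = 10 means that
   all 3-subsets occur and S carries a U_{3,6} minor. For k = 4 the trace property alone is incompatible
   with exactly 10 pairs: since 10 > 2^3, two blocks have the same trace on a third one, and from each
   of the resulting configurations a finite search produces an 11th pair.
   Conversely, completing the bases of a U_{3,6} minor by one fixed set
   yields bases of the matroid. *)

theory Submission
  imports Defs
begin

section \<open>Rank and multiple symmetric exchange\<close>

text \<open>Matroid union in rank-function form. If neither choice for \<open>e\<close> worked in the induction step,
  adding the two violated inequalities would contradict submodularity.\<close>

lemma submodular_partition:
  fixes r :: "'a set \<Rightarrow> nat"
  assumes mono: "\<And>X Y. X \<subseteq> Y \<Longrightarrow> r X \<le> r Y"
    and submod: "\<And>X Y. r (X \<union> Y) + r (X \<inter> Y) \<le> r X + r Y"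
    and "finite S"
    and "\<And>Y. Y \<subseteq> S \<Longrightarrow> card Y + c \<le> r (P \<union> Y) + r (Q \<union> Y)"
  shows "\<exists>T\<subseteq>S. card S + c \<le> r (P \<union> T) + r (Q \<union> (S - T))"
  using assms(3,4)
proof (induction S arbitrary: P Q c rule: finite_induct)
  case empty
  then show ?case by auto
next
  case (insert e S)
  show ?case
  \<comment> \<open>Placing \<open>e\<close> on the \<open>P\<close> side raises the constant by
    one, which pays for \<open>e\<close> in \<open>card (insert e S)\<close>. The second case split
    does the same for \<open>Q\<close>.\<close>
  proof (cases "\<forall>Y\<subseteq>S. card Y + Suc c \<le> r (insert e P \<union> Y) + r (Q \<union> Y)")
    case True
    then obtain T where T: "T \<subseteq> S" "card S + Suc c \<le> r (insert e P \<union> T) + r (Q \<union> (S - T))"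
      using insert.IH[of "Suc c" "insert e P" Q] by blast
    have "insert e S - insert e T = S - T" using insert.hyps T(1) by auto
    then show ?thesis using T insert.hyps by (intro exI[of _ "insert e T"]) auto
  next
    case False
    then obtain Y1 where Y1: "Y1 \<subseteq> S" "r (insert e P \<union> Y1) + r (Q \<union> Y1) \<le> card Y1 + c"
      by (auto simp: not_le)
    show ?thesis
    proof (cases "\<forall>Y\<subseteq>S. card Y + Suc c \<le> r (P \<union> Y) + r (insert e Q \<union> Y)")
      case True
      then obtain T where T: "T \<subseteq> S" "card S + Suc c \<le> r (P \<union> T) + r (insert e Q \<union> (S - T))"
        using insert.IH[of "Suc c" P "insert e Q"] by blast
      have "Q \<union> (insert e S - T) = insert e Q \<union> (S - T)" using insert.hyps T(1) by auto
      then show ?thesis using T insert.hyps by (intro exI[of _ T]) auto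
    next
      case False
      then obtain Y2 where Y2: "Y2 \<subseteq> S" "r (P \<union> Y2) + r (insert e Q \<union> Y2) \<le> card Y2 + c"
        by (auto simp: not_le)
      have fin: "finite Y1" "finite Y2" using Y1 Y2 insert.hyps finite_subset by blast+
      \<comment> \<open>The hypothesis at \<open>?U\<close> and at \<open>Y1 \<inter> Y2\<close>
        demands one more than the two violated inequalities allow; the surplus is
        \<open>e\<close>.\<close>
      let ?U = "insert e (Y1 \<union> Y2)"
      have U: "card ?U = Suc (card (Y1 \<union> Y2))" using fin Y1 Y2 insert.hyps by (subst card_insert_disjoint) auto
      have "r (P \<union> ?U) + r (P \<union> (Y1 \<inter> Y2)) \<le> r (insert e P \<union> Y1) + r (P \<union> Y2)"
        using submod[of "insert e P \<union> Y1" "P \<union> Y2"]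
          mono[of "P \<union> (Y1 \<inter> Y2)" "(insert e P \<union> Y1) \<inter> (P \<union> Y2)"]
        by (force simp: Un_ac)
      moreover have "r (Q \<union> ?U) + r (Q \<union> (Y1 \<inter> Y2)) \<le> r (Q \<union> Y1) + r (insert e Q \<union> Y2)"
        using submod[of "Q \<union> Y1" "insert e Q \<union> Y2"]
          mono[of "Q \<union> (Y1 \<inter> Y2)" "(Q \<union> Y1) \<inter> (insert e Q \<union> Y2)"]
        by (force simp: Un_ac)
      moreover have "card ?U + c \<le> r (P \<union> ?U) + r (Q \<union> ?U)"
        using Y1 Y2 by (intro insert.prems) auto
      moreover have "card (Y1 \<inter> Y2) + c \<le> r (P \<union> (Y1 \<inter> Y2)) + r (Q \<union> (Y1 \<inter> Y2))"
        using Y1 by (intro insert.prems) auto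
      moreover have "card (Y1 \<union> Y2) + card (Y1 \<inter> Y2) = card Y1 + card Y2"
        using card_Un_Int[OF fin] by simp
      ultimately have False using U Y1(2) Y2(2) by linarith
      then show ?thesis ..
    qed
  qed
qed

section \<open>Bases, independent sets and the rank function\<close>

locale base_matroid =
  fixes E :: "'a set" and Bs :: "'a set set"
  assumes matroid: "matroid E Bs"
begin

lemma finite_ground: "finite E"
  and bases_nonempty: "Bs \<noteq> {}"
  and base_subset: "B \<in> Bs \<Longrightarrow> B \<subseteq> E"
  and base_exchange: "\<lbrakk>B1 \<in> Bs; B2 \<in> Bs; x \<in> B1 - B2\<rbrakk> \<Longrightarrow> \<exists>y\<in>B2 - B1. insert y (B1 - {x}) \<in> Bs"
  using matroid unfolding matroid_def by blast+

lemma finite_base: "B \<in> Bs \<Longrightarrow> finite B"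
  using finite_ground base_subset finite_subset by blast

lemma finite_bases: "finite Bs"
  using finite_ground base_subset by (intro finite_subset[of Bs "Pow E"]) auto

lemma card_base:
  assumes "B1 \<in> Bs" "B2 \<in> Bs"
  shows "card B1 = card B2"
  using assms
proof (induction "card (B1 - B2) + card (B2 - B1)" arbitrary: B1 B2 rule: less_induct)
  case less
  note fin = finite_base[OF less.prems(1)] finite_base[OF less.prems(2)]
  show ?case
  proof (cases "B1 = B2")
    case False
    \<comment> \<open>Proved for an ordered pair, since at first only one of the two differences is
      known to be nonempty. An exchange removes one element from each.\<close>
    have *: "card B = card B'" if B: "B \<in> Bs" "B' \<in> Bs" and x: "x \<in> B - B'"
      and m: "card (B - B') + card (B' - B) = card (B1 - B2) + card (B2 - B1)" for B B' x
    proof -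
      obtain y where y: "y \<in> B' - B" "insert y (B - {x}) \<in> Bs"
        using base_exchange[OF B x] by blast
      let ?C = "insert y (B - {x})"
      note f = finite_base[OF B(1)] finite_base[OF B(2)]
      have "?C - B' = (B - B') - {x}" "B' - ?C = (B' - B) - {y}" using x y by auto
      then have "card (?C - B') < card (B - B')" "card (B' - ?C) < card (B' - B)"
        using f x y by (metis card_Diff1_less finite_Diff)+
      then have "card ?C = card B'" using less.hyps[of ?C B'] B y m by linarith
      moreover have "card ?C = card B" using f x y card_Suc_Diff1[of B x] by simp
      ultimately show ?thesis by simp
    qed
    from False obtain x where "x \<in> B1 - B2 \<or> x \<in> B2 - B1" by blast
    then show ?thesis using *[of B1 B2 x] *[of B2 B1 x] less.prems by auto
  qed simp
qed

lemma indep_subset: "\<lbrakk>indep Bs J; I \<subseteq> J\<rbrakk> \<Longrightarrow> indep Bs I"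
  unfolding indep_def by blast

lemma indep_finite: "indep Bs I \<Longrightarrow> finite I"
  unfolding indep_def using finite_base finite_subset by blast

text \<open>In a base containing \<open>I\<close>, exchanging an element outside
  \<open>I \<union> B\<close> for one of \<open>B\<close> keeps \<open>I\<close> and leaves fewer
  such elements.\<close>

lemma extend_in_base:
  assumes "indep Bs I" "B \<in> Bs"
  shows "\<exists>B'\<in>Bs. I \<subseteq> B' \<and> B' \<subseteq> I \<union> B"
proof -
  have "\<exists>B'\<in>Bs. I \<subseteq> B' \<and> B' \<subseteq> I \<union> B" if "B1 \<in> Bs" "I \<subseteq> B1" for B1
    using that
  proof (induction "card (B1 - (I \<union> B))" arbitrary: B1 rule: less_induct)
    case less
    show ?case
    proof (cases "B1 \<subseteq> I \<union> B")
      case False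
      then obtain x where x: "x \<in> B1 - (I \<union> B)" by blast
      then obtain y where y: "y \<in> B - B1" "insert y (B1 - {x}) \<in> Bs"
        using base_exchange[of B1 B x] less.prems assms by blast
      let ?C = "insert y (B1 - {x})"
      have "?C - (I \<union> B) = (B1 - (I \<union> B)) - {x}" using y by auto
      then have "card (?C - (I \<union> B)) < card (B1 - (I \<union> B))"
        using x finite_base[OF less.prems(1)] by (metis card_Diff1_less finite_Diff)
      then show ?thesis using less.hyps[of ?C] y x less.prems by blast
    qed (use less.prems in blast)
  qed
  then show ?thesis using assms unfolding indep_def by blast
qed

text \<open>If nothing in \<open>J - I\<close> augments \<open>I\<close>, then completing
  \<open>I\<close> from a base \<open>B\<close> that contains \<open>J\<close> adds only elements of
  \<open>B - J\<close>. The resulting base has at most |I| + |B| - |J| < |B| elements.\<close>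

lemma augment:
  assumes "indep Bs I" "indep Bs J" "card I < card J"
  shows "\<exists>x\<in>J - I. indep Bs (insert x I)"
proof (rule ccontr)
  assume no: "\<not> ?thesis"
  obtain B where B: "B \<in> Bs" "J \<subseteq> B" using assms(2) unfolding indep_def by blast
  obtain B' where B': "B' \<in> Bs" "I \<subseteq> B'" "B' \<subseteq> I \<union> B" using extend_in_base[OF assms(1) B(1)] by blast
  have "B' \<inter> (J - I) = {}" using no B' unfolding indep_def by blast
  then have "B' \<subseteq> I \<union> (B - J)" using B' by blast
  then have "card B' \<le> card (I \<union> (B - J))"
    using finite_base[OF B(1)] indep_finite[OF assms(1)] by (simp add: card_mono)
  also have "\<dots> \<le> card I + (card B - card J)"
    using card_Un_le[of I "B - J"] B finite_base[OF B(1)]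
    by (simp add: card_Diff_subset finite_subset)
  also have "\<dots> < card B" using assms(3) card_mono[OF finite_base[OF B(1)] B(2)] by linarith
  finally show False using card_base[OF B(1) B'(1)] by simp
qed

text \<open>The usual rank, stated through bases so that it makes sense for every set, also outside
  the ground set; monotonicity and submodularity then hold without side conditions.\<close>

definition rk :: "'a set \<Rightarrow> nat" where
  "rk X = Max ((\<lambda>B. card (B \<inter> X)) ` Bs)"

lemma rk_base_le: "B \<in> Bs \<Longrightarrow> card (B \<inter> X) \<le> rk X"
  unfolding rk_def using finite_bases by (intro Max_ge) auto

lemma rk_attained: "\<exists>B\<in>Bs. card (B \<inter> X) = rk X"
  using Max_in[of "(\<lambda>B. card (B \<inter> X)) ` Bs"] finite_bases bases_nonempty
  unfolding rk_def by (smt (verit) finite_imageI image_iff image_is_empty)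

lemma rk_indep_le: "\<lbrakk>indep Bs I; I \<subseteq> X\<rbrakk> \<Longrightarrow> card I \<le> rk X"
  unfolding indep_def using rk_base_le finite_base
  by (metis card_mono finite_Int le_inf_iff le_trans)

lemma rk_mono: "X \<subseteq> Y \<Longrightarrow> rk X \<le> rk Y"
  using rk_attained[of X] rk_base_le[of _ Y] finite_base
  by (metis Int_mono card_mono finite_Int le_trans order_refl)

lemma rk_le_card: "finite X \<Longrightarrow> rk X \<le> card X"
  using rk_attained[of X] by (metis card_mono inf_le2)

lemma indep_if_rk:
  assumes "finite X" "card X \<le> rk X"
  shows "indep Bs X"
proof -
  obtain B where B: "B \<in> Bs" "card (B \<inter> X) = rk X" using rk_attained by blast
  then have "B \<inter> X = X" using assms by (intro card_seteq) auto
  then show ?thesis unfolding indep_def using B by blast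
qed

text \<open>A trace \<open>B \<inter> Z\<close> whose size is the rank feeds \<open>augment\<close>
  until \<open>I\<close> has that size too.\<close>

lemma extend_to_rk:
  assumes "indep Bs I" "I \<subseteq> Z"
  shows "\<exists>J. I \<subseteq> J \<and> J \<subseteq> Z \<and> indep Bs J \<and> card J = rk Z"
  using assms
proof (induction "rk Z - card I" arbitrary: I rule: less_induct)
  case less
  have le: "card I \<le> rk Z" using rk_indep_le less.prems by blast
  show ?case
  proof (cases "card I = rk Z")
    case False
    obtain B where B: "B \<in> Bs" "card (B \<inter> Z) = rk Z" using rk_attained by blast
    have "indep Bs (B \<inter> Z)" unfolding indep_def using B by blast
    then obtain x where x: "x \<in> B \<inter> Z - I" "indep Bs (insert x I)"
      using augment[of I "B \<inter> Z"] less.prems B False le by auto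
    have "rk Z - card (insert x I) < rk Z - card I"
      using x indep_finite[OF less.prems(1)] False le by auto
    then show ?thesis using less.hyps[of "insert x I"] x less.prems by blast
  qed (use less.prems in blast)
qed

text \<open>A maximal independent subset \<open>I\<close> of \<open>X \<inter> Y\<close> extends to
  one \<open>J\<close> of \<open>X \<union> Y\<close>. The elements of \<open>I\<close> are counted
  both in \<open>J \<inter> X\<close> and in \<open>J \<inter> Y\<close>.\<close>

lemma rk_submodular: "rk (X \<union> Y) + rk (X \<inter> Y) \<le> rk X + rk Y"
proof -
  obtain B where B: "B \<in> Bs" "card (B \<inter> (X \<inter> Y)) = rk (X \<inter> Y)" using rk_attained by blast
  define I where "I = B \<inter> (X \<inter> Y)"
  have I: "indep Bs I" "I \<subseteq> X \<inter> Y" "card I = rk (X \<inter> Y)"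
    using B by (auto simp: I_def indep_def)
  then obtain J where J: "I \<subseteq> J" "J \<subseteq> X \<union> Y" "indep Bs J" "card J = rk (X \<union> Y)"
    using extend_to_rk[of I "X \<union> Y"] by blast
  have fin: "finite J" using indep_finite J by blast
  have "card J + card I \<le> card (J \<inter> X \<union> J \<inter> Y) + card ((J \<inter> X) \<inter> (J \<inter> Y))"
    using fin J I by (intro add_mono card_mono) auto
  also have "\<dots> = card (J \<inter> X) + card (J \<inter> Y)" using card_Un_Int[of "J \<inter> X" "J \<inter> Y"] fin by simp
  also have "\<dots> \<le> rk X + rk Y" using J by (intro add_mono rk_indep_le) (auto intro: indep_subset)
  finally show ?thesis using I J by simp
qed

lemma base_if_indep_card:
  assumes "indep Bs I" "B \<in> Bs" "card B \<le> card I"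
  shows "I \<in> Bs"
proof -
  obtain B' where B': "B' \<in> Bs" "I \<subseteq> B'" using assms unfolding indep_def by blast
  then have "I = B'" using card_base[OF B'(1) assms(2)] assms(3) finite_base
    by (intro card_seteq) auto
  then show ?thesis using B' by simp
qed

text \<open>\<open>submodular_partition\<close> is applied to the half-built bases
  \<open>C \<union> A\<close> and \<open>C \<union> (X - A)\<close>. Its hypothesis follows from
  submodularity: once \<open>Z \<subseteq> Y\<close> is added to both, their union contains the base
  \<open>C \<union> X\<close> and their intersection is the independent set
  \<open>C \<union> Z\<close>.\<close>

lemma multiple_symmetric_exchange:
  assumes B: "C \<union> X \<in> Bs" "C \<union> Y \<in> Bs" and disj: "C \<inter> X = {}" "C \<inter> Y = {}" "X \<inter> Y = {}"
    and A: "A \<subseteq> X"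
  shows "\<exists>T\<subseteq>Y. C \<union> (A \<union> T) \<in> Bs \<and> C \<union> ((X - A) \<union> (Y - T)) \<in> Bs"
proof -
  have fin: "finite C" "finite X" "finite Y" "finite A"
    using finite_base[OF B(1)] finite_base[OF B(2)] finite_subset[OF A] by auto
  let ?P = "C \<union> A" and ?Q = "C \<union> (X - A)"
  have cX: "card (C \<union> X) = card C + card X" and cY: "card (C \<union> Y) = card C + card Y"
    using disj fin by (auto simp: card_Un_disjoint)
  have cXY: "card X = card Y" using card_base[OF B] cX cY by simp
  have cA: "card A + card (X - A) = card X"
    using A fin by (metis add.commute card_Diff_subset card_mono le_add_diff_inverse2)
  \<comment> \<open>As |X| = |Y|, the left side is twice the size of a base.\<close>
  have "\<exists>T\<subseteq>Y. card Y + (2 * card C + card X) \<le> rk (?P \<union> T) + rk (?Q \<union> (Y - T))"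
  proof (rule submodular_partition[OF rk_mono rk_submodular fin(3)])
    fix Z assume Z: "Z \<subseteq> Y"
    have "(C \<union> A \<union> Z) \<inter> (C \<union> (X - A) \<union> Z) = C \<union> Z" using Z A disj by auto
    moreover have "(C \<union> A \<union> Z) \<union> (C \<union> (X - A) \<union> Z) = (C \<union> X) \<union> Z" using A by auto
    ultimately have "rk ((C \<union> X) \<union> Z) + rk (C \<union> Z) \<le> rk (?P \<union> Z) + rk (?Q \<union> Z)"
      using rk_submodular[of "?P \<union> Z" "?Q \<union> Z"] by simp
    moreover have "card (C \<union> X) \<le> rk ((C \<union> X) \<union> Z)"
      using B by (intro rk_indep_le) (auto simp: indep_def)
    moreover have "card (C \<union> Z) \<le> rk (C \<union> Z)"
      using B Z by (intro rk_indep_le) (auto simp: indep_def)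
    moreover have "card (C \<union> Z) = card C + card Z"
      using disj Z fin by (intro card_Un_disjoint) (auto intro: finite_subset)
    ultimately show "card Z + (2 * card C + card X) \<le> rk (?P \<union> Z) + rk (?Q \<union> Z)"
      using cX by linarith
  qed auto
  then obtain T where T: "T \<subseteq> Y"
    and le: "card Y + (2 * card C + card X) \<le> rk (?P \<union> T) + rk (?Q \<union> (Y - T))" by blast
  have fT: "finite T" using T fin finite_subset by blast
  have cT: "card T + card (Y - T) = card Y"
    using T fin fT by (metis add.commute card_Diff_subset card_mono le_add_diff_inverse2)
  have c1: "card (?P \<union> T) = card C + card A + card T"
    using disj A T fin fT by (subst card_Un_disjoint, auto, subst card_Un_disjoint, auto)
  have c2: "card (?Q \<union> (Y - T)) = card C + card (X - A) + card (Y - T)"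
    using disj A T fin fT by (subst card_Un_disjoint, auto, subst card_Un_disjoint, auto)
  have r1: "rk (?P \<union> T) \<le> card (?P \<union> T)" "rk (?P \<union> T) \<le> card C + card X"
    using rk_le_card[of "?P \<union> T"] rk_attained[of "?P \<union> T"] fin fT cX
      card_mono[OF finite_base] card_base[OF B(1)] by (auto, metis inf_le1)
  have r2: "rk (?Q \<union> (Y - T)) \<le> card (?Q \<union> (Y - T))" "rk (?Q \<union> (Y - T)) \<le> card C + card X"
    using rk_le_card[of "?Q \<union> (Y - T)"] rk_attained[of "?Q \<union> (Y - T)"] fin fT cX
      card_mono[OF finite_base] card_base[OF B(1)] by (auto, metis inf_le1)
  \<comment> \<open>Neither rank exceeds the size of a base, yet they sum to at least twice that
    size, so both are full. The two cardinalities have that same sum and bound the ranks from above,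
    so they agree with them.\<close>
  have "card (?P \<union> T) = rk (?P \<union> T)" "card (?Q \<union> (Y - T)) = rk (?Q \<union> (Y - T))"
    "card (?P \<union> T) = card (C \<union> X)" "card (?Q \<union> (Y - T)) = card (C \<union> X)"
    using le cX cXY cA cT c1 c2 r1 r2 by linarith+
  then have "?P \<union> T \<in> Bs" "?Q \<union> (Y - T) \<in> Bs"
    using B(1) fin fT by (auto intro!: base_if_indep_card[of _ "C \<union> X"] indep_if_rk)
  then show ?thesis using T by (intro exI[of _ T]) (simp add: Un_assoc)
qed

section \<open>Maximal independent subsets of a set, the building blocks of minors\<close>

lemma bases_of_card:
  assumes "I \<in> bases_of Bs Z"
  shows "card I = rk Z"
proof -
  have I: "I \<subseteq> Z" "indep Bs I" "\<And>J. \<lbrakk>I \<subseteq> J; J \<subseteq> Z; indep Bs J\<rbrakk> \<Longrightarrow> J = I"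
    using assms unfolding bases_of_def by auto
  then show ?thesis using extend_to_rk[of I Z] by metis
qed

lemma extend_bases_of:
  assumes "indep Bs I" "I \<subseteq> Z"
  shows "\<exists>J\<in>bases_of Bs Z. I \<subseteq> J"
proof -
  obtain J where J: "I \<subseteq> J" "J \<subseteq> Z" "indep Bs J" "card J = rk Z"
    using extend_to_rk[OF assms] by blast
  have "J' = J" if "J \<subseteq> J'" "J' \<subseteq> Z" "indep Bs J'" for J'
    using card_seteq[OF indep_finite[OF that(3)] that(1)] rk_indep_le[OF that(3,2)] J(4) by simp
  then show ?thesis using J unfolding bases_of_def by blast
qed

text \<open>The rank of \<open>Z\<close> is here the common size of all bases. This evaluates a
  deletion that keeps some base.\<close>

lemma bases_of_containing:
  assumes "B \<in> Bs" "B \<subseteq> Z"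
  shows "bases_of Bs Z = {B' \<in> Bs. B' \<subseteq> Z}"
proof -
  have indep: "indep Bs I" "I \<subseteq> Z" if "I \<in> bases_of Bs Z" for I
    using that by (auto simp: bases_of_def)
  have "card B \<le> rk Z" using assms by (intro rk_indep_le) (auto simp: indep_def)
  then have base: "I \<in> Bs" if "I \<in> bases_of Bs Z" for I
    using base_if_indep_card[OF indep(1)[OF that] assms(1)] bases_of_card[OF that] by simp
  moreover have "B' \<in> bases_of Bs Z" if "B' \<in> Bs" "B' \<subseteq> Z" for B'
  proof -
    obtain J where J: "J \<in> bases_of Bs Z" "B' \<subseteq> J"
      using extend_bases_of[of B' Z] \<open>B' \<in> Bs\<close> \<open>B' \<subseteq> Z\<close> by (auto simp: indep_def)
    have "B' = J"
      using card_seteq[OF finite_base[OF base[OF J(1)]] J(2)] card_base[OF \<open>B' \<in> Bs\<close> base[OF J(1)]] by simp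
    then show ?thesis using J by simp
  qed
  ultimately show ?thesis using indep(2) by blast
qed

text \<open>Subsets of \<open>Z\<close> are independent in the restriction to \<open>Z\<close>
  exactly when they are independent in the matroid. This removes the nesting of contraction over
  deletion.\<close>

lemma bases_of_bases_of:
  assumes "C \<subseteq> Z"
  shows "bases_of (bases_of Bs Z) C = bases_of Bs C"
proof -
  have "indep (bases_of Bs Z) I \<longleftrightarrow> indep Bs I" if "I \<subseteq> C" for I
    using extend_bases_of[of I Z] that assms indep_subset
    by (auto simp: indep_def[of "bases_of Bs Z"]) (auto simp: bases_of_def)
  then show ?thesis unfolding bases_of_def[of _ C] by blast
qed

text \<open>Complete \<open>I\<close> to a base \<open>B'\<close> inside
  \<open>I \<union> B\<close>. Maximality forces \<open>B' \<inter> Z = I\<close> and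
  \<open>B \<inter> Z = J\<close>, so \<open>B'\<close> lies in \<open>I \<union> (B - J)\<close>,
  and the sizes agree.\<close>

lemma bases_of_swap:
  assumes I: "I \<in> bases_of Bs Z" and J: "J \<in> bases_of Bs Z" and B: "B \<in> Bs" "J \<subseteq> B"
  shows "I \<union> (B - J) \<in> Bs"
proof -
  have Imax: "I \<subseteq> Z" "indep Bs I" "\<And>K. \<lbrakk>I \<subseteq> K; K \<subseteq> Z; indep Bs K\<rbrakk> \<Longrightarrow> K = I"
    using I unfolding bases_of_def by auto
  have Jmax: "J \<subseteq> Z" "\<And>K. \<lbrakk>J \<subseteq> K; K \<subseteq> Z; indep Bs K\<rbrakk> \<Longrightarrow> K = J"
    using J unfolding bases_of_def by auto
  obtain B' where B': "B' \<in> Bs" "I \<subseteq> B'" "B' \<subseteq> I \<union> B" using extend_in_base[OF Imax(2) B(1)] by blast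
  have "B' \<inter> Z = I" using Imax B' by (intro Imax(3)) (auto simp: indep_def)
  moreover have "B \<inter> Z = J" using Jmax(1) B by (intro Jmax(2)) (auto simp: indep_def)
  ultimately have sub: "B' \<subseteq> I \<union> (B - J)" using B' by blast
  have fB: "finite B" "finite J" using B finite_base finite_subset by blast+
  have "card (I \<union> (B - J)) \<le> card I + (card B - card J)"
    using card_Un_le[of I "B - J"] B fB by (simp add: card_Diff_subset)
  also have "\<dots> = card B'"
    using bases_of_card[OF I] bases_of_card[OF J] card_mono[OF fB(1) B(2)] card_base[OF B(1) B'(1)] by simp
  finally have "B' = I \<union> (B - J)" using sub fB indep_finite[OF Imax(2)] by (intro card_seteq) auto
  then show ?thesis using B' by simp
qed

end

section \<open>Families closed under complementation and exchange\<close>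

text \<open>Retains what the counting uses of the matroid: equal block size, closure under
  complements, and the trace property given by multiple symmetric exchange.\<close>

definition exchange_family :: "'a set \<Rightarrow> nat \<Rightarrow> 'a set set \<Rightarrow> bool" where
  "exchange_family S k P \<longleftrightarrow> finite S \<and>
     (\<forall>X\<in>P. X \<subseteq> S \<and> card X = k \<and> S - X \<in> P \<and> (\<forall>A\<subseteq>X. \<exists>D\<in>P. D \<inter> X = A))"

lemma exchange_familyD:
  assumes "exchange_family S k P"
  shows "finite S" and "finite P" and "\<And>X. X \<in> P \<Longrightarrow> X \<subseteq> S" and "\<And>X. X \<in> P \<Longrightarrow> finite X"
    and "\<And>X. X \<in> P \<Longrightarrow> card X = k" and "\<And>X. X \<in> P \<Longrightarrow> S - X \<in> P"
    and "\<And>X A. \<lbrakk>X \<in> P; A \<subseteq> X\<rbrakk> \<Longrightarrow> \<exists>D\<in>P. D \<inter> X = A"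
proof -
  show fS: "finite S" and sub: "\<And>X. X \<in> P \<Longrightarrow> X \<subseteq> S" and "\<And>X. X \<in> P \<Longrightarrow> card X = k"
    and "\<And>X. X \<in> P \<Longrightarrow> S - X \<in> P" and "\<And>X A. \<lbrakk>X \<in> P; A \<subseteq> X\<rbrakk> \<Longrightarrow> \<exists>D\<in>P. D \<inter> X = A"
    using assms unfolding exchange_family_def by auto
  show "finite P" using fS sub by (intro finite_subset[of P "Pow S"]) auto
  show "\<And>X. X \<in> P \<Longrightarrow> finite X" using fS sub finite_subset by blast
qed

text \<open>Complementation in \<open>S\<close> swaps the members containing \<open>x\<close> with
  the others, so the members containing \<open>x\<close> represent each complementary pair
  once.\<close>

lemma card_exchange_family_half:
  assumes "exchange_family S k P" "x \<in> S"
  shows "card P = 2 * card {X \<in> P. x \<in> X}"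
proof -
  note P = exchange_familyD[OF assms(1)]
  have "bij_betw (\<lambda>X. S - X) {X \<in> P. x \<in> X} {X \<in> P. x \<notin> X}"
    using P(3,6) assms(2) by (intro bij_betw_byWitness[where f' = "\<lambda>X. S - X"]) auto
  then have "card {X \<in> P. x \<in> X} = card {X \<in> P. x \<notin> X}" by (rule bij_betw_same_card)
  moreover have "card {X \<in> P. x \<in> X} + card {X \<in> P. x \<notin> X} = card ({X \<in> P. x \<in> X} \<union> {X \<in> P. x \<notin> X})"
    using P(2) by (intro card_Un_disjoint[symmetric]) auto
  moreover have "{X \<in> P. x \<in> X} \<union> {X \<in> P. x \<notin> X} = P" by blast
  ultimately show ?thesis by simp
qed

text \<open>By the trace property, these traces are all the subsets of \<open>X\<close> that contain
  \<open>x\<close>.\<close>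

lemma card_traces:
  assumes "exchange_family S k P" "X \<in> P" "x \<in> X"
  shows "card ((\<lambda>D. D \<inter> X) ` {D \<in> P. x \<in> D}) = 2 ^ (k - 1)"
proof -
  note P = exchange_familyD[OF assms(1)]
  have "(\<lambda>D. D \<inter> X) ` {D \<in> P. x \<in> D} = insert x ` Pow (X - {x})"
  proof (intro equalityI subsetI)
    fix A assume "A \<in> (\<lambda>D. D \<inter> X) ` {D \<in> P. x \<in> D}"
    then have "A = insert x (A - {x})" "A - {x} \<in> Pow (X - {x})" using assms(3) by auto
    then show "A \<in> insert x ` Pow (X - {x})" by blast
  next
    fix A assume "A \<in> insert x ` Pow (X - {x})"
    then have A: "A \<subseteq> X" "x \<in> A" using assms(3) by auto
    then obtain D where "D \<in> P" "D \<inter> X = A" using P(7)[OF assms(2)] by blast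
    then show "A \<in> (\<lambda>D. D \<inter> X) ` {D \<in> P. x \<in> D}" using A by auto
  qed
  moreover have "inj_on (insert x) (Pow (X - {x}))" by (intro inj_onI) blast
  ultimately show ?thesis using P(4,5)[OF assms(2)] assms(3) by (simp add: card_image card_Pow)
qed

text \<open>A block or its complement contains \<open>x\<close>; the traces on that one give the
  bound.\<close>

lemma card_exchange_family_ge:
  assumes "exchange_family S k P" "P \<noteq> {}" "x \<in> S"
  shows "2 ^ (k - 1) \<le> card {D \<in> P. x \<in> D}"
proof -
  note P = exchange_familyD[OF assms(1)]
  obtain X where "X \<in> P" "x \<in> X" using assms(2,3) P(6) by blast
  then show ?thesis
    using card_traces[OF assms(1)] card_image_le[of "{D \<in> P. x \<in> D}" "\<lambda>D. D \<inter> X"] P(2) by auto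
qed

text \<open>The search works with characteristic vectors, each complementary pair of sets being represented by
  its member containing the first element.\<close>

fun meet :: "bool list \<Rightarrow> bool list \<Rightarrow> bool list" where
  "meet (x # X) (d # D) = (if x then d else False) # meet X D"
| "meet _ _ = []"

definition neg :: "bool list \<Rightarrow> bool list" where
  "neg = map Not"

definition head_true :: "bool list \<Rightarrow> bool list" where
  "head_true D = (if hd D then D else neg D)"

text \<open>\<open>fill Y A k\<close> lists the \<open>k\<close>-element sets whose trace on \<open>Y\<close> is \<open>A\<close>.\<close>

fun fill :: "bool list \<Rightarrow> bool list \<Rightarrow> nat \<Rightarrow> bool list list" where
  "fill (y # Y) (a # A) k =
    (if y \<longrightarrow> a then (case k of 0 \<Rightarrow> [] | Suc j \<Rightarrow> map (Cons True) (fill Y A j)) else []) @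
    (if y \<and> a then [] else map (Cons False) (fill Y A k))"
| "fill _ _ k = (case k of 0 \<Rightarrow> [[]] | Suc _ \<Rightarrow> [])"

fun singles :: "bool list \<Rightarrow> bool list list" where
  "singles (y # Y) = (if y then [y # map (\<lambda>_. False) Y] else []) @ map (Cons False) (singles Y)"
| "singles [] = []"

text \<open>\<open>I\<close> holds one vector per complementary pair, so the complement of each
  entry is tested as well.\<close>

definition unmet :: "bool list list \<Rightarrow> bool list \<Rightarrow> bool list \<Rightarrow> bool" where
  "unmet I Y A \<longleftrightarrow> list_all (\<lambda>D. meet Y D \<noteq> A \<and> meet Y (neg D) \<noteq> A) I"

text \<open>The complement of a member is a member and makes its own demands, hence the second
  attempt with \<open>neg X\<close>. One-element traces suffice for the searches below.\<close>

primrec find_unmet :: "bool list list \<Rightarrow> bool list list \<Rightarrow> (bool list \<times> bool list) option" where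
  "find_unmet I [] = None"
| "find_unmet I (X # Xs) =
    (case List.find (unmet I X) (singles X) of Some A \<Rightarrow> Some (X, A) | None \<Rightarrow>
      (case List.find (unmet I (neg X)) (singles (neg X)) of Some A \<Rightarrow> Some (neg X, A) | None \<Rightarrow>
        find_unmet I Xs))"

text \<open>A branch is closed when \<open>I\<close> has at most \<open>length I - 3\<close> distinct traces on some member \<open>X\<close>: the whole
  family has 8 traces on \<open>X\<close> containing the first element, hence at least 11 representatives.
  The first argument only bounds the recursion depth.\<close>

primrec refutable :: "nat \<Rightarrow> bool list list \<Rightarrow> bool" where
  "refutable 0 I \<longleftrightarrow> False"
| "refutable (Suc n) I \<longleftrightarrow>
    list_ex (\<lambda>X. length (remdups (map (meet X) I)) + 3 \<le> length I) I \<or>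
    (case find_unmet I I of None \<Rightarrow> False
      | Some (Y, A) \<Rightarrow> list_all (\<lambda>D. refutable n (head_true D # I)) (fill Y A 4))"

section \<open>Characteristic vectors of sets and soundness of the search\<close>

definition bits :: "'a list \<Rightarrow> 'a set \<Rightarrow> bool list" where
  "bits xs A = map (\<lambda>x. x \<in> A) xs"

lemma meet_bits: "meet (bits xs X) (bits xs D) = bits xs (X \<inter> D)"
  unfolding bits_def by (induction xs) auto

lemma neg_bits: "A \<subseteq> set xs \<Longrightarrow> neg (bits xs A) = bits xs (set xs - A)"
  unfolding bits_def neg_def by auto

lemma neg_neg [simp]: "neg (neg X) = X"
  unfolding neg_def by (simp add: comp_def)

lemma bits_inject: "\<lbrakk>A \<subseteq> set xs; B \<subseteq> set xs; bits xs A = bits xs B\<rbrakk> \<Longrightarrow> A = B"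
  unfolding bits_def by auto

lemma bits_surj:
  assumes "distinct xs" "length L = length xs"
  shows "\<exists>A\<subseteq>set xs. bits xs A = L"
proof (intro exI conjI)
  let ?A = "{xs ! i | i. i < length xs \<and> L ! i}"
  show "?A \<subseteq> set xs" by auto
  show "bits xs ?A = L"
    using assms by (intro nth_equalityI) (auto simp: bits_def nth_eq_iff_index_eq)
qed

text \<open>Makes the branching exhaustive: a member realising a demanded trace is among the
  branches.\<close>

lemma fill_complete:
  "length D = length Y \<Longrightarrow> D \<in> set (fill Y (meet Y D) (length (filter id D)))"
proof (induction Y arbitrary: D)
  case (Cons y Y)
  then obtain d D' where D: "D = d # D'" "length D' = length Y" by (auto simp: length_Suc_conv)
  show ?case using Cons.IH[OF D(2)] D(1) by (cases y; cases d) simp_all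
qed simp

lemma length_filter_bits:
  assumes "distinct xs" "A \<subseteq> set xs"
  shows "length (filter id (bits xs A)) = card A"
proof -
  have "length (filter id (bits xs A)) = length (filter (\<lambda>x. x \<in> A) xs)"
    unfolding bits_def by (simp add: filter_map comp_def)
  also have "\<dots> = card (set (filter (\<lambda>x. x \<in> A) xs))" using assms by (simp only: distinct_card distinct_filter)
  also have "set (filter (\<lambda>x. x \<in> A) xs) = A" using assms by auto
  finally show ?thesis .
qed

lemma singles_below: "A \<in> set (singles Y) \<Longrightarrow> length A = length Y \<and> meet Y A = A"
proof (induction Y arbitrary: A)
  case (Cons y Y)
  have "meet Y (map (\<lambda>_. False) Y) = map (\<lambda>_. False) Y" for Y by (induction Y) auto
  with Cons show ?case by (auto split: if_splits)
qed simp

lemma find_unmet_Some: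
  "find_unmet I Xs = Some (Y, A) \<Longrightarrow>
    \<exists>X\<in>set Xs. (Y = X \<or> Y = neg X) \<and> A \<in> set (singles Y) \<and> unmet I Y A"
  by (induction Xs) (auto split: option.splits simp: find_Some_iff in_set_conv_nth)

text \<open>Induction on the depth. A pruned branch would contradict the count of traces. At an
  unmet demand the family has a member realising it, whose representative is one of the branches and
  extends \<open>I\<close> within \<open>F\<close>.\<close>

lemma refutable_sound:
  fixes xs :: "'a list" and P :: "'a set set"
  defines "F \<equiv> bits xs ` {X \<in> P. hd xs \<in> X}"
  assumes xs: "distinct xs" "xs \<noteq> []" and P: "exchange_family (set xs) 4 P" and "card P \<le> 20"
  shows "\<lbrakk>set I \<subseteq> F; distinct I\<rbrakk> \<Longrightarrow> \<not> refutable n I"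
proof (induction n arbitrary: I)
  case (Suc n)
  note PD = exchange_familyD[OF P]
  have finF: "finite F" unfolding F_def using PD(2) by simp
  have "card F \<le> 10"
    using card_exchange_family_half[OF P, of "hd xs"] xs(2) \<open>card P \<le> 20\<close>
      card_image_le[of "{X \<in> P. hd xs \<in> X}" "bits xs"] PD(2) unfolding F_def by simp
  \<comment> \<open>There are 8 traces on \<open>X\<close> within \<open>F\<close>. Those missed by
    \<open>I\<close> come from the at most \<open>10 - length I\<close> other vectors, so
    \<open>I\<close> itself has at least \<open>length I - 2\<close> traces.\<close>
  have no_prune: "\<not> length (remdups (map (meet X) I)) + 3 \<le> length I" if X: "X \<in> set I" for X
  proof -
    obtain X' where X': "X' \<in> P" "hd xs \<in> X'" "X = bits xs X'" using Suc.prems(1) X unfolding F_def by blast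
    have "meet X ` F = bits xs ` (\<lambda>D. D \<inter> X') ` {D \<in> P. hd xs \<in> D}"
      unfolding F_def image_image X'(3) meet_bits by (simp add: Int_commute)
    moreover have "inj_on (bits xs) ((\<lambda>D. D \<inter> X') ` {D \<in> P. hd xs \<in> D})"
      using PD(3) by (intro inj_onI bits_inject[of _ xs]) auto
    ultimately have "card (meet X ` F) = 8"
      using card_traces[OF P X'(1,2)] by (simp add: card_image)
    moreover have "meet X ` F \<subseteq> meet X ` set I \<union> meet X ` (F - set I)" by blast
    ultimately have "8 \<le> card (meet X ` set I) + card (F - set I)"
      using card_mono[of "meet X ` set I \<union> meet X ` (F - set I)" "meet X ` F"] finF
        card_Un_le[of "meet X ` set I" "meet X ` (F - set I)"] card_image_le[of "F - set I" "meet X"]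
      by auto
    moreover have "card (F - set I) + length I \<le> 10"
      using \<open>card F \<le> 10\<close> Suc.prems finF card_mono[OF finF Suc.prems(1)]
      by (simp add: card_Diff_subset distinct_card)
    ultimately show ?thesis by (simp add: length_remdups_card_conv)
  qed
  have False if found: "find_unmet I I = Some (Y, A)" and all: "list_all (\<lambda>D. refutable n (head_true D # I)) (fill Y A 4)" for Y A
  proof -
    obtain X where X: "X \<in> set I" "Y = X \<or> Y = neg X" "A \<in> set (singles Y)" "unmet I Y A"
      using find_unmet_Some[OF found] by blast
    then obtain X' where "X' \<in> P" "X = bits xs X'" using Suc.prems(1) unfolding F_def by blast
    then obtain Y' where Y': "Y' \<in> P" "Y = bits xs Y'" using X(2) PD(3,6) neg_bits by metis
    have A: "length A = length Y" "meet Y A = A" using singles_below[OF X(3)] by auto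
    then obtain A' where A': "A' \<subseteq> set xs" "bits xs A' = A"
      using bits_surj[OF xs(1), of A] Y'(2) by (auto simp: bits_def)
    have "Y' \<inter> A' = A'"
      using A(2) A' Y'(2) by (intro bits_inject[of _ xs]) (auto simp: meet_bits[symmetric])
    then obtain D where D: "D \<in> P" "D \<inter> Y' = A'" using PD(7)[OF Y'(1)] by blast
    have meetD: "meet Y (bits xs D) = A" using D(2) A'(2) Y'(2) by (simp add: meet_bits Int_commute)
    have "length (filter id (bits xs D)) = 4" using length_filter_bits[OF xs(1)] PD(3,5)[OF D(1)] by simp
    then have "bits xs D \<in> set (fill Y A 4)"
      using fill_complete[of "bits xs D" Y] meetD Y'(2) by (simp add: bits_def)
    then have ref: "refutable n (head_true (bits xs D) # I)" using all by (simp add: list_all_iff)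
    have hd: "hd (bits xs D) \<longleftrightarrow> hd xs \<in> D" using xs(2) by (simp add: bits_def hd_map)
    have "head_true (bits xs D) \<in> F"
      unfolding head_true_def hd F_def using D(1) PD(3,6)[OF D(1)] xs(2) by (auto simp: neg_bits)
    \<comment> \<open>If this vector were in \<open>I\<close>, then it or its negation would meet
      the demand, against \<open>unmet\<close>.\<close>
    moreover have "head_true (bits xs D) \<notin> set I"
      using X(4) meetD unfolding unmet_def list_all_iff head_true_def by auto
    ultimately show False using Suc.IH[of "head_true (bits xs D) # I"] Suc.prems ref by simp
  qed
  then show ?case using no_prune by (auto simp: list_ex_iff split: option.splits)
qed simp

lemma refutable_contradiction:
  assumes "distinct xs" "xs \<noteq> []" "exchange_family (set xs) 4 P" "card P = 20"
    and "\<forall>X\<in>set Xs. X \<in> P \<and> hd xs \<in> X" "distinct (map (bits xs) Xs)"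
    and "refutable n (map (bits xs) Xs)"
  shows False
  using refutable_sound[OF assms(1-3), of "map (bits xs) Xs" n] assms(4-7) by auto

section \<open>Four-element blocks\<close>

text \<open>The three possible ways for two members of the family to have the same trace, of size at
  least 2, on a third one.\<close>

lemma refutable_triple_extension:
  "refutable 10 [[True, True, True, False, True, False, False, False],
              [True, True, True, True, False, False, False, False],
              [True, True, True, False, False, True, False, False]]"
  by code_simp

lemma refutable_pair_overlapping:
  "refutable 10 [[True, True, False, False, True, True, False, False],
              [True, True, True, True, False, False, False, False],
              [True, True, False, False, True, False, True, False]]"
  by code_simp

lemma refutable_pair_disjoint:
  "refutable 10 [[True, True, False, False, False, False, True, True],
              [True, True, True, True, False, False, False, False],
              [True, True, False, False, True, True, False, False]]"
  by code_simp

lemma overlapping_pairs: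
  assumes "u \<noteq> v" "w \<noteq> z" "{u, v} \<noteq> {w, z}" "{u, v} \<inter> {w, z} \<noteq> {}"
  shows "\<exists>e f g. {u, v} = {e, f} \<and> {w, z} = {e, g} \<and> e \<noteq> f \<and> e \<noteq> g \<and> f \<noteq> g"
proof -
  consider "u = w" | "u = z" | "v = w" | "v = z" using assms(4) by auto
  then show ?thesis
  proof cases
    case 1
    then show ?thesis using assms by (intro exI[of _ u] exI[of _ v] exI[of _ z]) auto
  next
    case 2
    then show ?thesis using assms by (intro exI[of _ u] exI[of _ v] exI[of _ w]) auto
  next
    case 3
    then show ?thesis using assms by (intro exI[of _ v] exI[of _ u] exI[of _ z]) auto
  next
    case 4
    then show ?thesis using assms by (intro exI[of _ v] exI[of _ u] exI[of _ w]) auto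
  qed
qed

text \<open>Two members share a trace on \<open>X\<close>; it may be taken of size 2 or 3. In the
  case of size 2 the remainders outside \<open>X\<close> share one point or are disjoint.\<close>

lemma card_exchange_family_4:
  assumes P: "exchange_family S 4 P"
  shows "card P \<noteq> 20"
proof
  assume c20: "card P = 20"
  note PD = exchange_familyD[OF P]
  obtain X where X: "X \<in> P" using c20 by fastforce
  have cX: "card X = 4" "finite X" using PD(4,5)[OF X] by auto
  have cS: "card S = 8"
    using PD(5)[OF X] PD(5)[OF PD(6)[OF X]] PD(3)[OF X] PD(1) PD(4)[OF X] card_mono[OF PD(1) PD(3)[OF X]]
    by (simp add: card_Diff_subset)
  \<comment> \<open>All 20 members are counted here, not just representatives, against the 16
    subsets of \<open>X\<close>.\<close>
  have "card ((\<lambda>D. D \<inter> X) ` P) \<le> card (Pow X)" using cX(2) by (intro card_mono) auto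
  then have "card ((\<lambda>D. D \<inter> X) ` P) < card P" using c20 cX by (simp add: card_Pow)
  then obtain D0 D0' where D0: "D0 \<in> P" "D0' \<in> P" "D0 \<noteq> D0'" "D0 \<inter> X = D0' \<inter> X"
    using pigeonhole[of "\<lambda>D. D \<inter> X" P] unfolding inj_on_def by blast
  \<comment> \<open>If the common trace has at most one element, passing to both complements gives a
    common trace of at least 3.\<close>
  have "\<exists>D D'. D \<in> P \<and> D' \<in> P \<and> D \<noteq> D' \<and> D \<inter> X = D' \<inter> X \<and> 2 \<le> card (D \<inter> X)"
  proof (cases "2 \<le> card (D0 \<inter> X)")
    case False
    have "(S - D0) \<inter> X = X - D0 \<inter> X" "(S - D0') \<inter> X = X - D0' \<inter> X"
      using PD(3)[OF X] by auto
    moreover have "card (X - D0 \<inter> X) = 4 - card (D0 \<inter> X)" using cX by (simp add: card_Diff_subset)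
    moreover have "S - D0 \<noteq> S - D0'" using D0(3) PD(3)[OF D0(1)] PD(3)[OF D0(2)] by auto
    ultimately show ?thesis using D0 False PD(6)[OF D0(1)] PD(6)[OF D0(2)]
      by (intro exI[of _ "S - D0"] exI[of _ "S - D0'"]) simp
  qed (use D0 in blast)
  then obtain D D' where D: "D \<in> P" "D' \<in> P" "D \<noteq> D'" "D \<inter> X = D' \<inter> X" "2 \<le> card (D \<inter> X)" by blast
  define A where "A = D \<inter> X"
  have cD: "card D = 4" "card D' = 4" "finite D" "finite D'" using PD(4,5) D by auto
  have finA: "finite A" and AX: "A \<subseteq> X" using cX(2) by (auto simp: A_def)
  have "D - X = D - A" "D' - X = D' - A" "A \<subseteq> D" "A \<subseteq> D'" using D(4) by (auto simp: A_def)
  then have cdiff: "card (X - A) = 4 - card A" "card (D - X) = 4 - card A" "card (D' - X) = 4 - card A"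
    using finA AX cX cD by (simp_all add: card_Diff_subset)
  have Deq: "D = A \<union> (D - X)" "D' = A \<union> (D' - X)" "X = A \<union> (X - A)" using D(4) by (auto simp: A_def)
  have "card A \<noteq> 4"
  proof
    assume "card A = 4"
    then have "D - X = {}" "D' - X = {}" using cdiff cD by auto
    then show False using Deq(1,2) D(3) by (metis Un_empty_right)
  qed
  moreover have "card A \<le> 4" using card_mono[OF cX(2) AX] cX by simp
  ultimately consider "card A = 3" | "card A = 2" using D(5) unfolding A_def[symmetric] by linarith
  then show False
  proof cases
    case 1
    obtain a b c where A: "A = {a, b, c}" "distinct [a, b, c]" using 1 by (auto simp: card_3_iff)
    obtain d e f where def: "X - A = {d}" "D - X = {e}" "D' - X = {f}"
      using cdiff 1 by (auto simp: card_1_singleton_iff)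
    have X': "X = {a, b, c, d}" and D': "D = {a, b, c, e}" and D'': "D' = {a, b, c, f}"
      using Deq def A(1) by auto
    have "d \<notin> A" "e \<notin> X" "f \<notin> X" using def by auto
    moreover have "e \<noteq> f" using D(3) D' D'' by blast
    ultimately have dis: "distinct [a, b, c, d, e, f]" using A(2) unfolding X' A(1) by auto
    have sub: "{a, b, c, d, e, f} \<subseteq> S" using PD(3) X D(1,2) X' D' D'' by blast
    \<comment> \<open>Naming the rest of \<open>S\<close> enumerates it, so that \<open>D\<close>,
      \<open>X\<close>, \<open>D'\<close> become the vectors already refuted.\<close>
    have "card (S - {a, b, c, d, e, f}) = 2" using dis sub cS PD(1) by (simp add: card_Diff_subset)
    then obtain g h where gh: "S - {a, b, c, d, e, f} = {g, h}" "g \<noteq> h" by (auto simp: card_2_iff)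
    have S: "S = set [a, b, c, d, e, f, g, h]" using gh(1) sub by auto
    have "g \<in> S - {a, b, c, d, e, f}" "h \<in> S - {a, b, c, d, e, f}" using gh(1) by auto
    then have dis': "distinct [a, b, c, d, e, f, g, h]" using dis gh(2) by auto
    have "map (bits [a, b, c, d, e, f, g, h]) [D, X, D'] =
      [[True, True, True, False, True, False, False, False],
       [True, True, True, True, False, False, False, False],
       [True, True, True, False, False, True, False, False]]"
      using dis' unfolding X' D' D'' by (auto simp: bits_def)
    moreover have "\<forall>Y\<in>set [D, X, D']. Y \<in> P \<and> a \<in> Y" using X D(1,2) unfolding X' D' D'' by simp
    ultimately show False
      using refutable_triple_extension refutable_contradiction[OF dis' _ P[unfolded S] c20, of "[D, X, D']" 10] by simp
  next
    case 2
    obtain a b where A: "A = {a, b}" "a \<noteq> b" using 2 by (auto simp: card_2_iff)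
    obtain c d where cd: "X - A = {c, d}" "c \<noteq> d" using cdiff 2 by (auto simp: card_2_iff)
    have X': "X = {a, b, c, d}" using Deq(3) A(1) cd(1) by auto
    have "c \<notin> A" "d \<notin> A" using cd by auto
    then have abcd: "distinct [a, b, c, d]" using A cd(2) by auto
    obtain u v where uv: "D - X = {u, v}" "u \<noteq> v" using cdiff 2 by (auto simp: card_2_iff)
    obtain w z where wz: "D' - X = {w, z}" "w \<noteq> z" using cdiff 2 by (auto simp: card_2_iff)
    have "D - X \<noteq> D' - X" using Deq D(3) by auto
    then consider e f g where "D - X = {e, f}" "D' - X = {e, g}" "e \<noteq> f" "e \<noteq> g" "f \<noteq> g"
      | "(D - X) \<inter> (D' - X) = {}"
      using overlapping_pairs[OF uv(2) wz(2)] unfolding uv(1) wz(1) by metis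
    then show False
    proof cases
      case (1 e f g)
      have D': "D = {a, b, e, f}" and D'': "D' = {a, b, e, g}" using Deq 1 A(1) by auto
      have "e \<notin> X" "f \<notin> X" "g \<notin> X" using 1 by auto
      then have dis: "distinct [a, b, c, d, e, f, g]" using abcd 1 unfolding X' by auto
      have sub: "{a, b, c, d, e, f, g} \<subseteq> S" using PD(3) X D(1,2) X' D' D'' by blast
      have "card (S - {a, b, c, d, e, f, g}) = 1" using dis sub cS PD(1) by (simp add: card_Diff_subset)
      then obtain h where h: "S - {a, b, c, d, e, f, g} = {h}" by (auto simp: card_1_singleton_iff)
      have S: "S = set [a, b, c, d, e, f, g, h]" using h sub by auto
      have "h \<in> S - {a, b, c, d, e, f, g}" using h by auto
      then have dis': "distinct [a, b, c, d, e, f, g, h]" using dis by auto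
      have "map (bits [a, b, c, d, e, f, g, h]) [D, X, D'] =
        [[True, True, False, False, True, True, False, False],
         [True, True, True, True, False, False, False, False],
         [True, True, False, False, True, False, True, False]]"
        using dis' unfolding X' D' D'' by (auto simp: bits_def)
      moreover have "\<forall>Y\<in>set [D, X, D']. Y \<in> P \<and> a \<in> Y" using X D(1,2) unfolding X' D' D'' by simp
      ultimately show False
        using refutable_pair_overlapping refutable_contradiction[OF dis' _ P[unfolded S] c20, of "[D, X, D']" 10] by simp
    next
      case 2
      have D': "D = {a, b, u, v}" and D'': "D' = {a, b, w, z}" using Deq uv wz A(1) by auto
      have "u \<notin> X" "v \<notin> X" "w \<notin> X" "z \<notin> X" using uv wz by auto
      then have dis: "distinct [a, b, c, d, u, v, w, z]" using abcd 2 uv wz unfolding X' by auto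
      have "{a, b, c, d, u, v, w, z} \<subseteq> S" using PD(3) X D(1,2) X' D' D'' by blast
      moreover have "card {a, b, c, d, u, v, w, z} = card S" using dis cS by simp
      ultimately have S: "S = set [a, b, c, d, u, v, w, z]"
        using card_subset_eq[OF PD(1), of "{a, b, c, d, u, v, w, z}"] by simp
      \<comment> \<open>\<open>D'\<close> comes first to match the order in
        \<open>refutable_pair_disjoint\<close>.\<close>
      have "map (bits [a, b, c, d, u, v, w, z]) [D', X, D] =
        [[True, True, False, False, False, False, True, True],
         [True, True, True, True, False, False, False, False],
         [True, True, False, False, True, True, False, False]]"
        using dis unfolding X' D' D'' by (auto simp: bits_def)
      moreover have "\<forall>Y\<in>set [D', X, D]. Y \<in> P \<and> a \<in> Y" using X D(1,2) unfolding X' D' D'' by simp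
      ultimately show False
        using refutable_pair_disjoint refutable_contradiction[OF dis _ P[unfolded S] c20, of "[D', X, D]" 10] by simp
    qed
  qed
qed

section \<open>Complementary pairs of bases and uniform minors\<close>

text \<open>The sum has multiplicity two exactly on \<open>C\<close> and one exactly on
  \<open>S\<close>: \<open>C\<close> is the intersection of the two summands and \<open>S\<close>
  their symmetric difference.\<close>

lemma mset_set_sum_eq_iff:
  fixes C S X D1 D2 :: "'a set"
  assumes "finite D1" "finite D2" "C \<inter> S = {}" "X \<subseteq> S" "finite C" "finite S"
  shows "mset_set D1 + mset_set D2 = mset_set (C \<union> X) + mset_set (C \<union> (S - X)) \<longleftrightarrow>
    (\<exists>Y\<subseteq>S. D1 = C \<union> Y \<and> D2 = C \<union> (S - Y))" (is "?lhs \<longleftrightarrow> ?rhs")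
proof -
  have fX: "finite X" using assms finite_subset by blast
  have count: "count (mset_set U + mset_set V) a = of_bool (a \<in> U) + of_bool (a \<in> V)"
    if "finite U" "finite V" for U V :: "'a set" and a
    using that by simp
  show ?thesis
  proof
    assume ?lhs
    then have *: "of_bool (a \<in> D1) + of_bool (a \<in> D2) =
        (of_bool (a \<in> C \<union> X) + of_bool (a \<in> C \<union> (S - X)) :: nat)" for a
      using count[OF assms(1,2), of a] count[of "C \<union> X" "C \<union> (S - X)" a] assms(5,6) fX by simp
    have "a \<in> D1 \<and> a \<in> D2 \<longleftrightarrow> a \<in> C" "a \<in> D1 \<or> a \<in> D2 \<longleftrightarrow> a \<in> C \<or> a \<in> S" for a
      using *[of a] assms(3,4) by (auto simp: of_bool_def split: if_splits)
    then have "D1 - C \<subseteq> S" "D1 = C \<union> (D1 - C)" "D2 = C \<union> (S - (D1 - C))" using assms(3) by auto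
    then show ?rhs by blast
  next
    assume ?rhs
    then obtain Y where Y: "Y \<subseteq> S" "D1 = C \<union> Y" "D2 = C \<union> (S - Y)" by blast
    show ?lhs
    proof (rule multiset_eqI)
      fix a
      show "count (mset_set D1 + mset_set D2) a = count (mset_set (C \<union> X) + mset_set (C \<union> (S - X))) a"
        using count[OF assms(1,2), of a] count[of "C \<union> X" "C \<union> (S - X)" a] assms(3-6) fX Y
        by (auto simp: of_bool_def)
    qed
  qed
qed

context base_matroid
begin

text \<open>For nonempty \<open>S\<close>, each unordered pair of bases shows up here twice, as
  \<open>X\<close> and as \<open>S - X\<close>.\<close>

definition complementary :: "'a set \<Rightarrow> 'a set \<Rightarrow> 'a set set" where
  "complementary C S = {X. X \<subseteq> S \<and> C \<union> X \<in> Bs \<and> C \<union> (S - X) \<in> Bs}"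

text \<open>Multiple symmetric exchange between \<open>X\<close> and \<open>S - X\<close> yields the
  bases \<open>C \<union> D\<close> and \<open>C \<union> (S - D)\<close> with
  \<open>D = A \<union> T\<close>, so \<open>D\<close> is a block with trace \<open>A\<close>. The
  base \<open>C \<union> Z\<close> supplies the block size.\<close>

lemma exchange_family_complementary:
  assumes disj: "C \<inter> S = {}" and Z: "C \<union> Z \<in> Bs" "Z \<subseteq> S" and "finite S"
  shows "exchange_family S (card Z) (complementary C S)"
  unfolding exchange_family_def
proof (intro conjI ballI allI impI)
  show "finite S" by fact
  fix X assume "X \<in> complementary C S"
  then have X: "X \<subseteq> S" "C \<union> X \<in> Bs" "C \<union> (S - X) \<in> Bs" unfolding complementary_def by auto
  have "finite C" "finite X" "finite Z" using finite_base[OF X(2)] finite_base[OF Z(1)] by auto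
  then show "card X = card Z"
    using card_base[OF X(2) Z(1)] disj X(1) Z(2) card_Un_disjoint[of C X] card_Un_disjoint[of C Z]
    by (metis Int_mono add_left_cancel order_refl subset_empty)
  show "X \<subseteq> S" by (rule X(1))
  have "S - (S - X) = X" using X(1) by auto
  then show "S - X \<in> complementary C S" using X unfolding complementary_def by simp
  fix A assume A: "A \<subseteq> X"
  obtain T where T: "T \<subseteq> S - X" "C \<union> (A \<union> T) \<in> Bs" "C \<union> ((X - A) \<union> ((S - X) - T)) \<in> Bs"
    using multiple_symmetric_exchange[OF X(2,3) _ _ _ A] disj X(1) by blast
  have "(X - A) \<union> ((S - X) - T) = S - (A \<union> T)" using A T(1) X(1) by auto
  then have "A \<union> T \<in> complementary C S" using T A X(1) unfolding complementary_def by auto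
  moreover have "(A \<union> T) \<inter> X = A" using A T(1) by auto
  ultimately show "\<exists>D\<in>complementary C S. D \<inter> X = A" by blast
qed

lemma Delta_eq_card_half:
  assumes disj: "C \<inter> S = {}" and X: "X \<in> complementary C S" and x: "x \<in> S"
  shows "Delta Bs (C \<union> X) (C \<union> (S - X)) = card {Y \<in> complementary C S. x \<in> Y}"
proof -
  let ?P = "complementary C S"
  have X': "X \<subseteq> S" "C \<union> X \<in> Bs" "C \<union> (S - X) \<in> Bs" using X unfolding complementary_def by auto
  then have fin: "finite C" "finite S" using finite_base[of "C \<union> X"] finite_base[of "C \<union> (S - X)"]
    by (auto intro: finite_subset[of S "X \<union> (S - X)"])
  define g where "g Y = {C \<union> Y, C \<union> (S - Y)}" for Y
  have "{{D1, D2} | D1 D2. D1 \<in> Bs \<and> D2 \<in> Bs \<and>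
      mset_set D1 + mset_set D2 = mset_set (C \<union> X) + mset_set (C \<union> (S - X))} = g ` ?P"
  proof (intro equalityI subsetI)
    fix p assume "p \<in> {{D1, D2} | D1 D2. D1 \<in> Bs \<and> D2 \<in> Bs \<and>
      mset_set D1 + mset_set D2 = mset_set (C \<union> X) + mset_set (C \<union> (S - X))}"
    then obtain D1 D2 where D: "p = {D1, D2}" "D1 \<in> Bs" "D2 \<in> Bs"
      "mset_set D1 + mset_set D2 = mset_set (C \<union> X) + mset_set (C \<union> (S - X))" by blast
    then obtain Y where "Y \<subseteq> S" "D1 = C \<union> Y" "D2 = C \<union> (S - Y)"
      using mset_set_sum_eq_iff[OF finite_base[OF D(2)] finite_base[OF D(3)] disj X'(1) fin] by blast
    then show "p \<in> g ` ?P" using D unfolding g_def complementary_def by blast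
  next
    fix p assume "p \<in> g ` ?P"
    then obtain Y where Y: "Y \<subseteq> S" "C \<union> Y \<in> Bs" "C \<union> (S - Y) \<in> Bs" "p = {C \<union> Y, C \<union> (S - Y)}"
      unfolding g_def complementary_def by blast
    then have "mset_set (C \<union> Y) + mset_set (C \<union> (S - Y)) = mset_set (C \<union> X) + mset_set (C \<union> (S - X))"
      using mset_set_sum_eq_iff[OF finite_base[OF Y(2)] finite_base[OF Y(3)] disj X'(1) fin] by blast
    then show "p \<in> {{D1, D2} | D1 D2. D1 \<in> Bs \<and> D2 \<in> Bs \<and>
      mset_set D1 + mset_set D2 = mset_set (C \<union> X) + mset_set (C \<union> (S - X))}" using Y by blast
  qed
  also have "g ` ?P = g ` {Y \<in> ?P. x \<in> Y}"
  proof (intro equalityI subsetI)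
    fix p assume "p \<in> g ` ?P"
    then obtain Y where Y: "Y \<in> ?P" "p = g Y" by blast
    then have "Y \<subseteq> S" "S - (S - Y) = Y" unfolding complementary_def by auto
    then have "S - Y \<in> ?P" "p = g (S - Y)" using Y by (auto simp: g_def complementary_def)
    then show "p \<in> g ` {Y \<in> ?P. x \<in> Y}" using Y x by (cases "x \<in> Y") auto
  qed auto
  finally have "Delta Bs (C \<union> X) (C \<union> (S - X)) = card (g ` {Y \<in> ?P. x \<in> Y})" unfolding Delta_def by simp
  moreover have "inj_on g {Y \<in> ?P. x \<in> Y}"
  proof (rule inj_onI)
    fix Y Z assume Y: "Y \<in> {Y \<in> ?P. x \<in> Y}" and Z: "Z \<in> {Y \<in> ?P. x \<in> Y}" and eq: "g Y = g Z"
    \<comment> \<open>\<open>x\<close> tells the two members of a pair apart: it lies in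
      \<open>C \<union> Y\<close> but not in \<open>C \<union> (S - Y)\<close>.\<close>
    have "x \<notin> C" using x disj by blast
    then have "C \<union> Y = C \<union> Z" using eq Y Z unfolding g_def by (auto simp: doubleton_eq_iff)
    then show "Y = Z" using Y Z disj unfolding complementary_def by auto
  qed
  ultimately show ?thesis by (simp add: card_image)
qed

lemma minor_bases_eq:
  assumes "C \<subseteq> E - A"
  shows "minor_bases E Bs A C =
    {X. X \<subseteq> E - A - C \<and> (\<exists>J\<in>bases_of Bs C. X \<union> J \<in> bases_of Bs (E - A))}"
  unfolding minor_bases_def contr_bases_def del_bases_def bases_of_bases_of[OF assms] ..

text \<open>\<open>L\<close> consists of a maximal independent subset of \<open>C\<close> together with the elements of \<open>A\<close> that complete
  one fixed base of the deletion to a base.\<close>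

lemma minor_bases_lift:
  assumes "C \<subseteq> E - A"
  shows "\<exists>L. L \<inter> (E - A - C) = {} \<and> (\<forall>X\<in>minor_bases E Bs A C. L \<union> X \<in> Bs)"
proof (cases "minor_bases E Bs A C = {}")
  case False
  then obtain X0 J where X0: "X0 \<subseteq> E - A - C" and J: "J \<in> bases_of Bs C"
    and XJ: "X0 \<union> J \<in> bases_of Bs (E - A)"
    unfolding minor_bases_eq[OF assms] by blast
  have XJmax: "\<And>K. \<lbrakk>X0 \<union> J \<subseteq> K; K \<subseteq> E - A; indep Bs K\<rbrakk> \<Longrightarrow> K = X0 \<union> J" and "indep Bs (X0 \<union> J)"
    using XJ unfolding bases_of_def by auto
  then obtain B where B: "B \<in> Bs" "X0 \<union> J \<subseteq> B" unfolding indep_def by blast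
  \<comment> \<open>Maximality in the deletion: beyond \<open>X0 \<union> J\<close>, the base
    \<open>B\<close> has only elements of \<open>A\<close>.\<close>
  have BA: "B \<inter> (E - A) = X0 \<union> J"
    using B XJ by (intro XJmax) (auto simp: indep_def bases_of_def)
  have JC: "J \<subseteq> C" using J unfolding bases_of_def by blast
  define K where "K = B - (X0 \<union> J)"
  have K: "K \<inter> (E - A) = {}" using BA unfolding K_def by blast
  have "J \<union> K \<union> X \<in> Bs" if X: "X \<in> minor_bases E Bs A C" for X
  proof -
    obtain J' where J': "X \<subseteq> E - A - C" "J' \<in> bases_of Bs C" "X \<union> J' \<in> bases_of Bs (E - A)"
      using X unfolding minor_bases_eq[OF assms] by blast
    \<comment> \<open>Two swaps: first within \<open>E - A\<close>, keeping \<open>K\<close>, and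
      then \<open>J'\<close> for \<open>J\<close> within \<open>C\<close>.\<close>
    have base: "X \<union> J' \<union> K \<in> Bs" using bases_of_swap[OF J'(3) XJ B] unfolding K_def .
    have "J' \<subseteq> C" using J'(2) unfolding bases_of_def by blast
    then have "J \<union> (X \<union> J' \<union> K - J') = J \<union> K \<union> X" using J'(1) K assms by auto
    moreover have "J \<union> (X \<union> J' \<union> K - J') \<in> Bs" using bases_of_swap[OF J J'(2) base] by blast
    ultimately show ?thesis by simp
  qed
  moreover have "(J \<union> K) \<inter> (E - A - C) = {}" using K JC by blast
  ultimately show ?thesis by blast
qed auto

text \<open>\<open>C\<close> is independent, hence its own unique maximal independent subset, and
  \<open>C \<union> S\<close> contains a base, so the deletion just keeps the bases inside
  it.\<close>

lemma minor_bases_contract: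
  assumes "C \<union> X \<in> Bs" "X \<subseteq> S" "C \<inter> S = {}" "S \<subseteq> E"
  shows "minor_bases E Bs (E - (C \<union> S)) C = {Y. Y \<subseteq> S \<and> C \<union> Y \<in> Bs}"
proof -
  have CE: "C \<subseteq> E" using base_subset[OF assms(1)] by blast
  have G: "E - (E - (C \<union> S)) = C \<union> S" using CE assms(4) by blast
  have "indep Bs C" using assms(1) unfolding indep_def by blast
  then have "bases_of Bs C = {C}" unfolding bases_of_def by auto
  moreover have "bases_of Bs (C \<union> S) = {B \<in> Bs. B \<subseteq> C \<union> S}"
    using assms(1,2) by (intro bases_of_containing) auto
  moreover have "C \<union> S - C = S" using assms(3) by blast
  ultimately show ?thesis
    by (subst minor_bases_eq) (auto simp: G Un_commute)
qed

end

section \<open>Recognising the uniform matroid\<close>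

lemma matroid_iso_U36_iff:
  assumes "Ms \<subseteq> Pow S"
  shows "matroid_iso S Ms U36_ground U36_bases \<longleftrightarrow>
    finite S \<and> card S = 6 \<and> Ms = {X. X \<subseteq> S \<and> card X = 3}"
proof -
  \<comment> \<open>Any bijection matches the triples on both sides, so both directions can use
    whichever one is at hand.\<close>
  have image: "(`) f ` {X. X \<subseteq> S \<and> card X = 3} = U36_bases" if f: "bij_betw f S U36_ground" for f
  proof (intro equalityI subsetI)
    fix Y assume "Y \<in> (`) f ` {X. X \<subseteq> S \<and> card X = 3}"
    then obtain X where X: "X \<subseteq> S" "card X = 3" "Y = f ` X" by blast
    then have "card Y = 3"
      using bij_betw_imp_inj_on[OF f] by (metis card_image inj_on_subset)
    then show "Y \<in> U36_bases"
      using X bij_betw_imp_surj_on[OF f] unfolding U36_bases_def U36_ground_def by auto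
  next
    fix Y assume "Y \<in> U36_bases"
    then have Y: "Y \<subseteq> f ` S" "card Y = 3"
      using bij_betw_imp_surj_on[OF f] unfolding U36_bases_def U36_ground_def by auto
    then obtain X where X: "X \<subseteq> S" "Y = f ` X" by (meson subset_image_iff)
    then have "card X = 3"
      using Y(2) bij_betw_imp_inj_on[OF f] by (metis card_image inj_on_subset)
    then show "Y \<in> (`) f ` {X. X \<subseteq> S \<and> card X = 3}" using X by blast
  qed
  show ?thesis
  proof
    assume "matroid_iso S Ms U36_ground U36_bases"
    then obtain f where f: "bij_betw f S U36_ground" "U36_bases = (`) f ` Ms"
      unfolding matroid_iso_def by blast
    have "inj_on ((`) f) (Pow S)"
      using bij_betw_imp_inj_on[OF f(1)] by (rule inj_on_image_Pow)
    moreover have "(`) f ` Ms = (`) f ` {X. X \<subseteq> S \<and> card X = 3}" using image[OF f(1)] f(2) by simp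
    ultimately have "Ms = {X. X \<subseteq> S \<and> card X = 3}"
      using assms by (subst (asm) inj_on_image_eq_iff) auto
    moreover have "finite S" "card S = 6"
      using bij_betw_finite[OF f(1)] bij_betw_same_card[OF f(1)] by (auto simp: U36_ground_def)
    ultimately show "finite S \<and> card S = 6 \<and> Ms = {X. X \<subseteq> S \<and> card X = 3}" by blast
  next
    assume S: "finite S \<and> card S = 6 \<and> Ms = {X. X \<subseteq> S \<and> card X = 3}"
    then obtain f where "bij_betw f S U36_ground"
      using ex_bij_betw_finite_nat[of S] unfolding U36_ground_def by auto
    then show "matroid_iso S Ms U36_ground U36_bases"
      using image S unfolding matroid_iso_def by blast
  qed
qed

lemma card_subsets_containing:
  assumes "finite S" "x \<in> S"
  shows "card {Y. Y \<subseteq> S \<and> x \<in> Y \<and> card Y = Suc j} = (card S - 1) choose j"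
proof -
  let ?T = "{Z. Z \<subseteq> S - {x} \<and> card Z = j}"
  have "{Y. Y \<subseteq> S \<and> x \<in> Y \<and> card Y = Suc j} = insert x ` ?T"
  proof (intro equalityI subsetI)
    fix Y assume Y: "Y \<in> {Y. Y \<subseteq> S \<and> x \<in> Y \<and> card Y = Suc j}"
    then have "Y - {x} \<in> ?T" "Y = insert x (Y - {x})" by (auto simp: insert_absorb)
    then show "Y \<in> insert x ` ?T" by blast
  next
    fix Y assume "Y \<in> insert x ` ?T"
    then obtain Z where Z: "Z \<subseteq> S - {x}" "card Z = j" "Y = insert x Z" by blast
    then have "finite Z" "x \<notin> Z" using assms(1) finite_subset by auto
    then show "Y \<in> {Y. Y \<subseteq> S \<and> x \<in> Y \<and> card Y = Suc j}" using Z assms(2) by auto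
  qed
  moreover have "inj_on (insert x) ?T" by (intro inj_onI) blast
  ultimately show ?thesis using n_subsets[of "S - {x}" j] assms by (simp add: card_image)
qed

section \<open>Uniform minors and the value 10 of \<open>Delta\<close>\<close>

context base_matroid
begin

lemma Delta_eq_10_uniform:
  assumes "L \<inter> S = {}" "card S = 6" and bases: "\<And>X. \<lbrakk>X \<subseteq> S; card X = 3\<rbrakk> \<Longrightarrow> L \<union> X \<in> Bs"
  shows "\<exists>B1\<in>Bs. \<exists>B2\<in>Bs. Delta Bs B1 B2 = 10"
proof -
  have fin: "finite S" using assms(2) card.infinite by fastforce
  obtain X where X: "X \<subseteq> S" "card X = 3" using obtain_subset_with_card_n[of 3 S] assms(2) by auto
  obtain x where x: "x \<in> X" using X(2) by fastforce
  have compl: "card (S - Y) = 3" if "Y \<subseteq> S" "card Y = 3" for Y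
    using that(2) assms(2) card_Diff_subset[OF finite_subset[OF that(1) fin] that(1)] by simp
  have LX: "L \<union> X \<in> Bs" "L \<union> (S - X) \<in> Bs" using bases compl X by auto
  \<comment> \<open>Guarantees that every block is a triple, so that nothing else is
    counted.\<close>
  have fam: "exchange_family S 3 (complementary L S)"
    using exchange_family_complementary[OF assms(1) LX(1) X(1) fin] X(2) by simp
  have "Y \<in> complementary L S \<longleftrightarrow> Y \<subseteq> S \<and> card Y = 3" for Y
  proof
    show "Y \<subseteq> S \<and> card Y = 3" if "Y \<in> complementary L S"
      using exchange_familyD(3,5)[OF fam that] by simp
    show "Y \<in> complementary L S" if "Y \<subseteq> S \<and> card Y = 3"
      unfolding complementary_def using that bases[of Y] bases[of "S - Y"] compl[of Y] by simp
  qed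
  then have "{Y \<in> complementary L S. x \<in> Y} = {Y. Y \<subseteq> S \<and> x \<in> Y \<and> card Y = Suc 2}" by auto
  \<comment> \<open>The triples through \<open>x\<close> number 5 choose 2.\<close>
  moreover have "card {Y. Y \<subseteq> S \<and> x \<in> Y \<and> card Y = Suc 2} = 10"
    using card_subsets_containing[OF fin, of x 2] x X(1) assms(2) by (auto simp: numeral_eq_Suc)
  moreover have "X \<in> complementary L S" using LX X(1) unfolding complementary_def by simp
  ultimately have "Delta Bs (L \<union> X) (L \<union> (S - X)) = 10"
    using Delta_eq_card_half[OF assms(1), of X x] x X(1) by auto
  then show ?thesis using LX by blast
qed

text \<open>With \<open>k = Suc j\<close>, the bounds 2^j \<le> 10 \<le> (2j+1 choose j) leave
  \<open>j = 2\<close> and \<open>j = 3\<close>; the search excludes the latter.\<close>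

lemma uniform_if_Delta_eq_10:
  assumes B: "B1 \<in> Bs" "B2 \<in> Bs" and Delta: "Delta Bs B1 B2 = 10"
  defines "C \<equiv> B1 \<inter> B2" and "S \<equiv> (B1 - B2) \<union> (B2 - B1)"
  shows "card S = 6" and "{Y. Y \<subseteq> S \<and> C \<union> Y \<in> Bs} = {Y. Y \<subseteq> S \<and> card Y = 3}"
proof -
  define X where "X = B1 - B2"
  define k where "k = card X"
  have fin: "finite S" "finite X" using finite_base B unfolding S_def X_def by auto
  have disj: "C \<inter> S = {}" and XS: "X \<subseteq> S" and B1: "C \<union> X = B1" and SX: "S - X = B2 - B1" and B2: "C \<union> (S - X) = B2"
    unfolding C_def S_def X_def by auto
  let ?P = "complementary C S"
  have XP: "X \<in> ?P" unfolding complementary_def using XS B B1 B2 by simp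
  have fam: "exchange_family S k ?P"
    unfolding k_def using exchange_family_complementary[OF disj _ XS fin(1)] B1 B(1) by simp
  note P = exchange_familyD[OF fam]
  have cS: "card S = 2 * k"
    using P(5)[OF XP] P(5)[OF P(6)[OF XP]] card_mono[OF fin(1) XS] fin XS by (simp add: card_Diff_subset)
  \<comment> \<open>Otherwise \<open>B1 = B2\<close>, and \<open>Delta\<close> would be at most
    1.\<close>
  have "S \<noteq> {}"
  proof
    assume "S = {}"
    then have "B1 = B2" unfolding S_def by blast
    have "D1 = B1 \<and> D2 = B1" if "D1 \<in> Bs" "D2 \<in> Bs" "mset_set D1 + mset_set D2 = mset_set B1 + mset_set B2" for D1 D2
      using mset_set_sum_eq_iff[of D1 D2 B1 "{}" "{}"] that finite_base B \<open>B1 = B2\<close> by auto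
    then have "{{D1, D2} | D1 D2. D1 \<in> Bs \<and> D2 \<in> Bs \<and>
       mset_set D1 + mset_set D2 = mset_set B1 + mset_set B2} \<subseteq> {{B1}}" by auto
    from card_mono[OF _ this] show False using Delta unfolding Delta_def by simp
  qed
  then obtain x where x: "x \<in> S" by blast
  define j where "j = k - 1"
  have k: "k = Suc j" using cS x fin(1) unfolding j_def by (cases k) auto
  have half: "card {Y \<in> ?P. x \<in> Y} = 10"
    using Delta_eq_card_half[OF disj XP x] Delta unfolding B1 B2 by simp
  have sub: "{Y \<in> ?P. x \<in> Y} \<subseteq> {Y. Y \<subseteq> S \<and> x \<in> Y \<and> card Y = Suc j}"
    using P(3,5) k by auto
  have fin': "finite {Y. Y \<subseteq> S \<and> x \<in> Y \<and> card Y = Suc j}" using fin(1) by simp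
  have c: "card {Y. Y \<subseteq> S \<and> x \<in> Y \<and> card Y = Suc j} = Suc (2 * j) choose j"
    using card_subsets_containing[OF fin(1) x] cS k by simp
  have "2 ^ j \<le> (10::nat)" using card_exchange_family_ge[OF fam _ x] XP half k by auto
  then have "j < 4" using power_increasing[of 4 j "2::nat"] by (cases "j < 4") auto
  moreover have "j \<noteq> 3"
    using card_exchange_family_4[of S ?P] fam k card_exchange_family_half[OF fam x] half by auto
  moreover have "10 \<le> Suc (2 * j) choose j" using card_mono[OF fin' sub] half c by simp
  ultimately have j: "j = 2" by (auto simp: less_Suc_eq numeral_eq_Suc)
  then show "card S = 6" using cS k by simp
  \<comment> \<open>There are just 10 triples through \<open>x\<close>, so all of them
    occur.\<close>
  have eq: "{Y \<in> ?P. x \<in> Y} = {Y. Y \<subseteq> S \<and> x \<in> Y \<and> card Y = Suc j}"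
    using c half j by (intro card_subset_eq[OF fin' sub]) (simp add: numeral_eq_Suc)
  have "C \<union> Y \<in> Bs" if Y: "Y \<subseteq> S" "card Y = 3" for Y
  proof (cases "x \<in> Y")
    case True
    then show ?thesis using eq Y j unfolding complementary_def by (auto simp: numeral_3_eq_3)
  next
    case False
    have "card (S - Y) = 3"
      using Y(2) \<open>card S = 6\<close> card_Diff_subset[OF finite_subset[OF Y(1) fin(1)] Y(1)] by simp
    then have "S - Y \<in> ?P" using eq x False j by (auto simp: numeral_3_eq_3)
    moreover have "S - (S - Y) = Y" using Y(1) by blast
    ultimately show ?thesis unfolding complementary_def by auto
  qed
  moreover have "card Y = 3" if Y: "Y \<subseteq> S" "C \<union> Y \<in> Bs" for Y
  proof -
    have "card (C \<union> Y) = card (C \<union> X)" using card_base[OF Y(2) B(1)] B1 by simp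
    moreover have "finite C" using finite_base[OF B(1)] unfolding C_def by simp
    moreover have "C \<inter> Y = {}" "C \<inter> X = {}" "finite Y" using disj Y(1) XS fin finite_subset by auto
    ultimately show ?thesis using fin(2) k j unfolding k_def by (simp add: card_Un_disjoint)
  qed
  ultimately show "{Y. Y \<subseteq> S \<and> C \<union> Y \<in> Bs} = {Y. Y \<subseteq> S \<and> card Y = 3}" by blast
qed

end

theorem theorem3p5:
  fixes E :: "'a set" and Bs :: "'a set set"
  assumes "matroid E Bs"
  shows "(\<exists>A C. A \<subseteq> E \<and> C \<subseteq> E \<and> A \<inter> C = {} \<and>
            matroid_iso (E - A - C) (minor_bases E Bs A C) U36_ground U36_bases)
         \<longleftrightarrow> (\<exists>B1\<in>Bs. \<exists>B2\<in>Bs. Delta Bs B1 B2 = 10)"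
proof -
  interpret base_matroid E Bs by unfold_locales (rule assms)
  show ?thesis
  proof
    assume "\<exists>A C. A \<subseteq> E \<and> C \<subseteq> E \<and> A \<inter> C = {} \<and>
            matroid_iso (E - A - C) (minor_bases E Bs A C) U36_ground U36_bases"
    then obtain A C where AC: "C \<subseteq> E" "A \<inter> C = {}"
      and iso: "matroid_iso (E - A - C) (minor_bases E Bs A C) U36_ground U36_bases" by blast
    have C: "C \<subseteq> E - A" using AC by blast
    have "minor_bases E Bs A C \<subseteq> Pow (E - A - C)" unfolding minor_bases_eq[OF C] by blast
    then have "card (E - A - C) = 6" and "minor_bases E Bs A C = {X. X \<subseteq> E - A - C \<and> card X = 3}"
      using iso matroid_iso_U36_iff by blast+
    moreover obtain L where "L \<inter> (E - A - C) = {}" "\<forall>X\<in>minor_bases E Bs A C. L \<union> X \<in> Bs"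
      using minor_bases_lift[OF C] by blast
    ultimately show "\<exists>B1\<in>Bs. \<exists>B2\<in>Bs. Delta Bs B1 B2 = 10"
      by (intro Delta_eq_10_uniform[of L "E - A - C"]) auto
  next
    assume "\<exists>B1\<in>Bs. \<exists>B2\<in>Bs. Delta Bs B1 B2 = 10"
    then obtain B1 B2 where B: "B1 \<in> Bs" "B2 \<in> Bs" "Delta Bs B1 B2 = 10" by blast
    \<comment> \<open>The minor restricts to \<open>B1 \<union> B2\<close> and contracts
      \<open>B1 \<inter> B2\<close>, leaving the symmetric difference.\<close>
    define C S where "C = B1 \<inter> B2" and "S = (B1 - B2) \<union> (B2 - B1)"
    have "card S = 6" and bases: "{Y. Y \<subseteq> S \<and> C \<union> Y \<in> Bs} = {Y. Y \<subseteq> S \<and> card Y = 3}"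
      unfolding C_def S_def using uniform_if_Delta_eq_10[OF B] by auto
    have "C \<union> S \<subseteq> E" "C \<inter> S = {}" "C \<union> (B1 - B2) = B1" "B1 - B2 \<subseteq> S"
      using base_subset B unfolding C_def S_def by auto
    then have "minor_bases E Bs (E - (C \<union> S)) C = {Y. Y \<subseteq> S \<and> card Y = 3}"
      using minor_bases_contract[of C "B1 - B2" S] B(1) bases by simp
    moreover have "E - (E - (C \<union> S)) - C = S" using \<open>C \<union> S \<subseteq> E\<close> \<open>C \<inter> S = {}\<close> by blast
    moreover have "finite S" using \<open>card S = 6\<close> card.infinite by fastforce
    ultimately have "matroid_iso (E - (E - (C \<union> S)) - C) (minor_bases E Bs (E - (C \<union> S)) C) U36_ground U36_bases"
      using matroid_iso_U36_iff[of "{Y. Y \<subseteq> S \<and> card Y = 3}" S] \<open>card S = 6\<close> by auto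
    then show "\<exists>A C. A \<subseteq> E \<and> C \<subseteq> E \<and> A \<inter> C = {} \<and>
            matroid_iso (E - A - C) (minor_bases E Bs A C) U36_ground U36_bases"
      using \<open>C \<union> S \<subseteq> E\<close> by (intro exI[of _ "E - (C \<union> S)"] exI[of _ C]) blast
  qed
qed

end
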